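(* Let $p$ be an odd prime and let $G\cong \mathbb{Z}_{p^{t_1}}\oplus\mathbb{Z}_{p^{t_2}}\oplus\cdots\oplus\mathbb{Z}_{p^{t_m}}$ with $1\le t_1\le\cdots\le t_m$, $|G|=n$. Let $1\le k\le n$ and $x=(x_1,\dots,x_m)\in G$ with $x_i\in\mathbb{Z}_{p^{t_i}}$. Then $(G,\mathcal{B}_k^x)$ is a $1$-$(n,k,r)$ design (for some $r$) if and only if $p\mid k$ and the pair $(k,x)$ satisfies one of the following: (i) $p^{t_m}\mid k$, $k\neq n$, and $x\in G$ is arbitrary; or $k=n$ and $x=0$; (ii) $k\neq n$, and there exists at least one $i$, $1\le i\le m$, with $p\nmid x_i$; (iii) $k\neq n$, $p\mid x_i$ for all $1\le i\le m$, and $\max\{\nu_p(k)-\nu_p^i(x_i): 1\le i\le m\}\ge 1$, where $\nu_p^i(x)=\nu_p(x)$ if $x\not\equiv 0\pmod{p^{t_i}}$ and $\nu_p^i(x)=\infty$ if $x\equiv 0\pmod{p^{t_i}}$.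
   Context: $\mathcal{B}_k^x$ is the family of all $k$-subsets of $G$ whose elements sum to $x$; $(G,\mathcal{B}_k^x)$ is a $1$-$(n,k,r)$ design if every element of $G$ lies in exactly $r$ of these subsets. Elements $x_i\in\mathbb{Z}_{p^{t_i}}$ are identified with integer representatives in $\{0,\dots,p^{t_i}-1\}$ for divisibility statements. $\nu_p(N)$ is the $p$-adic valuation of the integer $N$ ($\nu_p(0)=\infty$).
   Formalization: A 1-(n,k,r) design is required to have r ≥ 1; with r = 0 allowed, the claim fails for k = n and x ≠ 0, where there are no blocks and every element lies in exactly 0 of them. *)

theory Defs
  imports
    "HOL-Algebra.FiniteProduct"
    "HOL-Algebra.Product_Groups"
    "HOL-Number_Theory.Cong"
    "HOL-Computational_Algebra.Primes"
    "HOL-Library.Extended_Real"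
begin

text \<open>
  \<open>r\<close> is required to be positive, as is usual for block designs; for \<open>n, k > 0\<close>
  this excludes precisely the structures without blocks.
\<close>

definition one_design :: "'a set \<Rightarrow> 'a set set \<Rightarrow> nat \<Rightarrow> nat \<Rightarrow> nat \<Rightarrow> bool" where
  "one_design V \<B> n k r \<longleftrightarrow>
     finite V \<and> card V = n \<and> (\<forall>b\<in>\<B>. b \<subseteq> V \<and> card b = k) \<and>
     0 < r \<and> (\<forall>v\<in>V. card {b \<in> \<B>. v \<in> b} = r)"

text \<open>
  The abelian group \<open>G\<close> is written multiplicatively by the library, so the sum of the
  elements of \<open>b\<close> is \<^const>\<open>finprod\<close> and the zero element is \<open>\<one>\<^bsub>G\<^esub>\<close>.
\<close>

definition blocks :: "('a, 'b) monoid_scheme \<Rightarrow> nat \<Rightarrow> 'a \<Rightarrow> 'a set set" where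
  "blocks G k x = {b. b \<subseteq> carrier G \<and> finite b \<and> card b = k \<and> finprod G (\<lambda>g. g) b = x}"

text \<open>
  Extended reals give the intended reading to differences of valuations: in
  \<open>\<nu> p k - \<nu>_loc p t y\<close> with \<open>k > 0\<close> the first term is finite, so an infinite
  second term yields \<open>-\<infinity>\<close>.
\<close>

definition \<nu> :: "nat \<Rightarrow> int \<Rightarrow> ereal" where
  "\<nu> p N = (if N = 0 then \<infinity> else ereal (real (multiplicity (int p) N)))"

definition \<nu>_loc :: "nat \<Rightarrow> nat \<Rightarrow> int \<Rightarrow> ereal" where
  "\<nu>_loc p t y = (if [y = 0] (mod int (p ^ t)) then \<infinity> else \<nu> p y)"

end

theory Submission
  imports Defs
begin

text \<open>
  Write \<open>kG\<close> for the set of \<open>k\<close>-th multiples (\<open>k\<close>-th powers in the multiplicative notation of the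
  library). For \<open>k < n\<close> the criterion says that \<open>x \<notin> kG\<close> or \<open>kG = 0\<close>. Translating a block
  through \<open>v\<close> by \<open>- v\<close> shows that the number of blocks through \<open>v\<close> is \<open>c (x - k v)\<close>, where \<open>c y\<close>
  counts the \<open>(k - 1)\<close>-subsets of \<open>G - {0}\<close> with sum \<open>y\<close>; so the question is whether \<open>c\<close> is
  constant on \<open>x + kG\<close>. The counts for consecutive sizes satisfy a linear recursion. By induction
  along it, \<open>c\<close> is invariant under translation by \<open>p\<^sup>sG\<close> outside \<open>p\<^sup>sG\<close>, whereas its sums over the
  two cosets \<open>p\<^bsup>s+1\<^esup>G\<close> and \<open>w + p\<^bsup>s+1\<^esup>G\<close> differ for every \<open>w\<close> in \<open>p\<^sup>sG\<close> outside \<open>p\<^bsup>s+1\<^esup>G\<close>. With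
  \<open>kG = p\<^sup>sG\<close> both directions follow. Blocks exist for \<open>k < n\<close> because \<open>n\<close> is odd, so that the
  nonzero elements fall into pairs \<open>{a, - a}\<close>.
\<close>

text \<open>The count \<open>c\<close> of the overview; the size \<open>j\<close> stays variable
  because the recursion runs over it.\<close>

definition punctured_count :: "('a, 'b) monoid_scheme \<Rightarrow> nat \<Rightarrow> 'a \<Rightarrow> nat" where
  "punctured_count G j y = card {b \<in> blocks G j y. \<one>\<^bsub>G\<^esub> \<notin> b}"

definition powers :: "('a, 'b) monoid_scheme \<Rightarrow> nat \<Rightarrow> 'a set" where
  "powers G j = (\<lambda>g. g [^]\<^bsub>G\<^esub> j) ` carrier G"

section \<open>Blocks through a point and the recursion for their number\<close>

context comm_group
begin

lemma blocksD:
  assumes "b \<in> blocks G j y"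
  shows "b \<subseteq> carrier G" "finite b" "card b = j" "finprod G (\<lambda>g. g) b = y"
  using assms by (auto simp: blocks_def)

lemma finite_blocks: "finite (carrier G) \<Longrightarrow> finite (blocks G j y)"
  by (rule finite_subset[of _ "Pow (carrier G)"]) (auto simp: blocks_def)

lemma inj_on_mult_left: "v \<in> carrier G \<Longrightarrow> A \<subseteq> carrier G \<Longrightarrow> inj_on ((\<otimes>) v) A"
  by (rule inj_on_subset[OF inj_on_cmult])

text \<open>Each of the \<open>j\<close> elements contributes one extra factor \<open>v\<close> to
  the product.\<close>

lemma translate_block:
  assumes b: "b \<in> blocks G j y" and v: "v \<in> carrier G"
  shows "(\<otimes>) v ` b \<in> blocks G j (v [^] j \<otimes> y)"
proof -
  note B = blocksD[OF b]
  have inj: "inj_on ((\<otimes>) v) b" by (rule inj_on_mult_left[OF v B(1)])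
  have "finprod G (\<lambda>g. g) ((\<otimes>) v ` b) = finprod G (\<lambda>g. v \<otimes> g) b"
    using v B(1) by (subst finprod_reindex[OF _ inj]) auto
  also have "\<dots> = finprod G (\<lambda>g. v) b \<otimes> finprod G (\<lambda>g. g) b"
    using v B(1) by (subst finprod_multf[symmetric]) auto
  also have "\<dots> = v [^] j \<otimes> y"
    using v B by (simp add: finprod_const)
  finally show ?thesis
    using v B inj by (auto simp: blocks_def card_image)
qed

lemma translate_back:
  assumes "v \<in> carrier G" "b \<subseteq> carrier G"
  shows "(\<otimes>) (inv v) ` (\<otimes>) v ` b = b" "(\<otimes>) v ` (\<otimes>) (inv v) ` b = b"
proof -
  have "(\<lambda>x. inv v \<otimes> (v \<otimes> x)) ` b = id ` b" "(\<lambda>x. v \<otimes> (inv v \<otimes> x)) ` b = id ` b"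
    using assms by (auto simp: m_assoc[symmetric] subset_eq intro!: image_cong)
  then show "(\<otimes>) (inv v) ` (\<otimes>) v ` b = b" "(\<otimes>) v ` (\<otimes>) (inv v) ` b = b"
    by (simp_all add: image_image)
qed

text \<open>The neutral element does not affect the product, so deleting it is a bijection that
  changes only the size.\<close>

lemma card_blocks_through_one:
  assumes y: "y \<in> carrier G"
  shows "card {b \<in> blocks G (Suc j) y. \<one> \<in> b} = punctured_count G j y"
  unfolding punctured_count_def
proof (rule bij_betw_same_card[of "\<lambda>b. b - {\<one>}"], rule bij_betw_byWitness[where f' = "insert \<one>"])
  show "(\<lambda>b. b - {\<one>}) ` {b \<in> blocks G (Suc j) y. \<one> \<in> b} \<subseteq> {b \<in> blocks G j y. \<one> \<notin> b}"
  proof clarsimp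
    fix b assume b: "b \<in> blocks G (Suc j) y" and 1: "\<one> \<in> b"
    note B = blocksD[OF b]
    have "finprod G (\<lambda>g. g) (insert \<one> (b - {\<one>})) = \<one> \<otimes> finprod G (\<lambda>g. g) (b - {\<one>})"
      using B by (intro finprod_insert) auto
    moreover have "finprod G (\<lambda>g. g) (b - {\<one>}) \<in> carrier G"
      using B by (intro finprod_closed) auto
    ultimately show "b - {\<one>} \<in> blocks G j y"
      using B 1 by (auto simp: blocks_def insert_absorb)
  qed
  show "insert \<one> ` {b \<in> blocks G j y. \<one> \<notin> b} \<subseteq> {b \<in> blocks G (Suc j) y. \<one> \<in> b}"
  proof clarsimp
    fix b assume b: "b \<in> blocks G j y" and 1: "\<one> \<notin> b"
    note B = blocksD[OF b]
    have "finprod G (\<lambda>g. g) (insert \<one> b) = \<one> \<otimes> finprod G (\<lambda>g. g) b"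
      using B 1 by (intro finprod_insert) auto
    then show "insert \<one> b \<in> blocks G (Suc j) y"
      using B 1 y by (auto simp: blocks_def)
  qed
qed auto

text \<open>Translation by \<open>inv v\<close> moves \<open>v\<close> to \<open>\<one>\<close>.
  Regularity of the design thus becomes constancy of \<open>punctured_count G j\<close> on a coset
  of \<open>powers G (Suc j)\<close>.\<close>

lemma card_blocks_through:
  assumes y: "y \<in> carrier G" and v: "v \<in> carrier G"
  shows "card {b \<in> blocks G (Suc j) y. v \<in> b} = punctured_count G j (y \<otimes> inv (v [^] Suc j))"
proof -
  let ?z = "y \<otimes> inv (v [^] Suc j)"
  have yz: "inv v [^] Suc j \<otimes> y = ?z" "v [^] Suc j \<otimes> ?z = y"
    using y v m_lcomm[of "v [^] Suc j" y "inv (v [^] Suc j)"] nat_pow_inv[OF v, of "Suc j"]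
    by (simp_all add: m_comm[of _ y] del: nat_pow_Suc)
  have "card {b \<in> blocks G (Suc j) y. v \<in> b} = card {b \<in> blocks G (Suc j) ?z. \<one> \<in> b}"
  proof (rule bij_betw_same_card[of "\<lambda>b. (\<otimes>) (inv v) ` b"],
      rule bij_betw_byWitness[where f' = "\<lambda>b. (\<otimes>) v ` b"])
    show "(\<lambda>b. (\<otimes>) (inv v) ` b) ` {b \<in> blocks G (Suc j) y. v \<in> b} \<subseteq> {b \<in> blocks G (Suc j) ?z. \<one> \<in> b}"
      using translate_block[of _ "Suc j" y "inv v"] v yz by (force simp del: nat_pow_Suc)
    show "(\<lambda>b. (\<otimes>) v ` b) ` {b \<in> blocks G (Suc j) ?z. \<one> \<in> b} \<subseteq> {b \<in> blocks G (Suc j) y. v \<in> b}"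
      using translate_block[of _ "Suc j" ?z v] v yz by (force simp del: nat_pow_Suc)
    show "\<forall>b\<in>{b \<in> blocks G (Suc j) y. v \<in> b}. (\<otimes>) v ` (\<otimes>) (inv v) ` b = b"
      and "\<forall>b\<in>{b \<in> blocks G (Suc j) ?z. \<one> \<in> b}. (\<otimes>) (inv v) ` (\<otimes>) v ` b = b"
      by (intro ballI translate_back[OF v]; auto dest: blocksD(1))+
  qed
  also have "\<dots> = punctured_count G j ?z"
    using y v by (intro card_blocks_through_one) auto
  finally show ?thesis .
qed

lemma card_blocks_Suc:
  assumes fin: "finite (carrier G)" and y: "y \<in> carrier G"
  shows "card (blocks G (Suc j) y) = punctured_count G (Suc j) y + punctured_count G j y"
proof -
  let ?A = "{b \<in> blocks G (Suc j) y. \<one> \<notin> b}" and ?B = "{b \<in> blocks G (Suc j) y. \<one> \<in> b}"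
  have "card (blocks G (Suc j) y) = card (?A \<union> ?B)"
    by (rule arg_cong[where f = card]) auto
  also have "\<dots> = card ?A + card ?B"
    using finite_blocks[OF fin] by (intro card_Un_disjoint) auto
  finally show ?thesis
    by (simp only: card_blocks_through_one[OF y] punctured_count_def)
qed

text \<open>Double counting of incident pairs of a point and a block.\<close>

lemma sum_punctured_count:
  assumes fin: "finite (carrier G)" and y: "y \<in> carrier G"
  shows "(\<Sum>v\<in>carrier G. punctured_count G j (y \<otimes> inv (v [^] Suc j)))
    = Suc j * card (blocks G (Suc j) y)"
proof -
  have "(\<Sum>v\<in>carrier G. card {b \<in> blocks G (Suc j) y. v \<in> b}) = Suc j * card (blocks G (Suc j) y)"
  proof (rule sum_multicount[OF fin finite_blocks[OF fin]], rule ballI)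
    fix b assume "b \<in> blocks G (Suc j) y"
    then have "b \<subseteq> carrier G" "card b = Suc j" by (auto dest: blocksD)
    then show "card {i \<in> carrier G. i \<in> b} = Suc j"
      by (metis Collect_mem_eq Int_def inf.absorb_iff2)
  qed
  then show ?thesis
    using card_blocks_through[OF y] by simp
qed

text \<open>This is Newton's identity for elementary symmetric polynomials and power sums, read off
  in the group algebra.\<close>

lemma punctured_count_Suc:
  assumes fin: "finite (carrier G)" and y: "y \<in> carrier G"
  shows "Suc j * (punctured_count G (Suc j) y + punctured_count G j y)
    = (\<Sum>v\<in>carrier G. punctured_count G j (y \<otimes> inv (v [^] Suc j)))"
  using card_blocks_Suc[OF fin y] sum_punctured_count[OF fin y] by simp

lemma punctured_count_0: "punctured_count G 0 y = (if y = \<one> then 1 else 0)"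
proof -
  have "{b \<in> blocks G 0 y. \<one> \<notin> b} = (if y = \<one> then {{}} else {})"
    by (auto simp: blocks_def card_eq_0_iff)
  then show ?thesis by (simp add: punctured_count_def)
qed

section \<open>The subgroups of powers\<close>

lemma powersI: "g \<in> carrier G \<Longrightarrow> g [^] j \<in> powers G j"
  by (simp add: powers_def)

lemma powers_subgroup: "subgroup (powers G j) G"
proof
  show "powers G j \<subseteq> carrier G" by (auto simp: powers_def)
  show "x \<otimes> y \<in> powers G j" if "x \<in> powers G j" "y \<in> powers G j" for x y
    using that by (auto simp: powers_def nat_pow_distrib[symmetric])
  show "\<one> \<in> powers G j" by (force simp: powers_def)
  show "inv x \<in> powers G j" if "x \<in> powers G j" for x
    using that by (auto simp: powers_def nat_pow_inv[symmetric])
qed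

lemma powers_mono_dvd: "i dvd j \<Longrightarrow> powers G j \<subseteq> powers G i"
  by (force simp: powers_def nat_pow_pow[symmetric] mult.commute elim!: dvdE)

text \<open>By Bezout, \<open>gcd j e\<close> is a multiple of \<open>j\<close> up to a multiple of
  the exponent \<open>e\<close>, which acts trivially.\<close>

lemma powers_gcd_exponent:
  assumes "\<forall>g\<in>carrier G. g [^] (e::nat) = \<one>" "0 < j"
  shows "powers G (gcd j e) \<subseteq> powers G j"
proof
  fix h assume "h \<in> powers G (gcd j e)"
  then obtain g where g: "g \<in> carrier G" "h = g [^] gcd j e" by (auto simp: powers_def)
  obtain u v where "j * u = e * v + gcd j e" using bezout_nat[of j e] assms by auto
  then have "g [^] (u * j) = (g [^] e) [^] v \<otimes> g [^] gcd j e"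
    using g by (simp add: nat_pow_mult nat_pow_pow mult.commute)
  then have "(g [^] u) [^] j = h"
    using g assms by (simp add: nat_pow_pow)
  then show "h \<in> powers G j" using g powersI[of "g [^] u" j] by simp
qed

text \<open>Only the \<open>p\<close>-part of \<open>j\<close> matters when the exponent is a power
  of \<open>p\<close>. Together with \<open>powers_mono_dvd\<close> this identifies
  \<open>powers G j\<close> with \<open>powers G (p ^ s)\<close> when \<open>p ^ s\<close> is the
  exact power of \<open>p\<close> in \<open>j\<close>.\<close>

lemma powers_prime_power_subset:
  assumes ex: "\<forall>g\<in>carrier G. g [^] (p ^ e) = \<one>" and p: "prime (p::nat)"
    and j: "0 < j" and nd: "\<not> p ^ Suc s dvd j"
  shows "powers G (p ^ s) \<subseteq> powers G j"
proof -
  obtain i where i: "i \<le> e" "gcd j (p ^ e) = p ^ i"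
    using divides_primepow_nat[OF p, of "gcd j (p ^ e)" e] by auto
  have "p ^ i dvd j" using i(2) gcd_dvd1 by metis
  then have "i \<le> s" using nd by (meson dvd_trans le_imp_power_dvd not_less_eq_eq)
  then have "powers G (p ^ s) \<subseteq> powers G (gcd j (p ^ e))"
    by (intro powers_mono_dvd) (simp add: i le_imp_power_dvd)
  then show ?thesis using powers_gcd_exponent[OF ex j] by blast
qed

section \<open>Translation invariance of the counts\<close>

lemma sum_translate:
  assumes "h \<in> carrier G"
  shows "(\<Sum>v\<in>carrier G. f (h \<otimes> v)) = (\<Sum>v\<in>carrier G. f v)"
proof (rule sum.reindex_bij_betw[of "(\<otimes>) h"], rule bij_betw_byWitness[where f' = "(\<otimes>) (inv h)"])
qed (use assms in \<open>auto simp: m_assoc[symmetric]\<close>)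

text \<open>If \<open>h = w [^] j\<close>, the substitution of \<open>w \<otimes> v\<close> for
  \<open>v\<close> absorbs the shift.\<close>

lemma sum_powers_shift:
  assumes h: "h \<in> powers G j" and y: "y \<in> carrier G"
  shows "(\<Sum>v\<in>carrier G. f (y \<otimes> h \<otimes> inv (v [^] j))) = (\<Sum>v\<in>carrier G. f (y \<otimes> inv (v [^] j)))"
proof -
  obtain w where w: "w \<in> carrier G" "h = w [^] j" using h by (auto simp: powers_def)
  have "y \<otimes> h \<otimes> inv ((w \<otimes> v) [^] j) = y \<otimes> inv (v [^] j)" if v: "v \<in> carrier G" for v
  proof -
    have "h \<otimes> inv ((w \<otimes> v) [^] j) = h \<otimes> inv h \<otimes> inv (v [^] j)"
      using w v by (simp add: nat_pow_distrib inv_mult m_assoc[symmetric] del: r_inv)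
    then show ?thesis using w v y by (simp add: m_assoc)
  qed
  then show ?thesis
    using sum_translate[OF w(1), of "\<lambda>v. f (y \<otimes> h \<otimes> inv (v [^] j))"] by simp
qed

text \<open>Induction along the recursion, whose right-hand side ignores \<open>h\<close> in both
  cases. If \<open>p ^ s\<close> divides \<open>Suc j\<close>, all arguments stay outside
  \<open>powers G (p ^ s)\<close> and the induction hypothesis applies termwise; otherwise
  \<open>h\<close> lies in \<open>powers G (Suc j)\<close> and is absorbed by reindexing.\<close>

lemma punctured_count_shift:
  assumes fin: "finite (carrier G)"
    and ex: "\<forall>g\<in>carrier G. g [^] (p ^ e) = \<one>" and p: "prime (p::nat)"
    and y: "y \<in> carrier G" "y \<notin> powers G (p ^ s)" and h: "h \<in> powers G (p ^ s)"
  shows "punctured_count G j (y \<otimes> h) = punctured_count G j y"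
  using y
proof (induction j arbitrary: y)
  case 0
  interpret H: subgroup "powers G (p ^ s)" G by (rule powers_subgroup)
  have "y \<noteq> \<one>" using 0 by auto
  moreover have "y \<otimes> h \<noteq> \<one>"
  proof
    assume "y \<otimes> h = \<one>"
    then have "y = inv h" using 0 h by (metis H.mem_carrier inv_equality inv_inv)
    then show False using 0 h by auto
  qed
  ultimately show ?case by (simp add: punctured_count_0)
next
  case (Suc j)
  interpret H: subgroup "powers G (p ^ s)" G by (rule powers_subgroup)
  have hc: "h \<in> carrier G" using h by simp
  have "(\<Sum>v\<in>carrier G. punctured_count G j (y \<otimes> h \<otimes> inv (v [^] Suc j)))
      = (\<Sum>v\<in>carrier G. punctured_count G j (y \<otimes> inv (v [^] Suc j)))"
  proof (cases "p ^ s dvd Suc j")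
    case True
    show ?thesis
    proof (rule sum.cong[OF refl])
      fix v assume v: "v \<in> carrier G"
      let ?a = "inv (v [^] Suc j)"
      have "v [^] Suc j \<in> powers G (p ^ s)"
        using powers_mono_dvd[OF True] powersI[OF v] by blast
      then have a: "?a \<in> powers G (p ^ s)" by (rule H.m_inv_closed)
      have "y \<otimes> ?a \<notin> powers G (p ^ s)"
      proof
        assume "y \<otimes> ?a \<in> powers G (p ^ s)"
        then have "y \<otimes> ?a \<otimes> inv ?a \<in> powers G (p ^ s)" using a by blast
        then show False using Suc.prems v by (simp add: m_assoc del: nat_pow_Suc)
      qed
      then have "punctured_count G j (y \<otimes> ?a \<otimes> h) = punctured_count G j (y \<otimes> ?a)"
        using Suc.prems v by (intro Suc.IH) auto
      moreover have "y \<otimes> ?a \<otimes> h = y \<otimes> h \<otimes> ?a"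
        using Suc.prems v hc by (simp add: m_ac del: nat_pow_Suc)
      ultimately show "punctured_count G j (y \<otimes> h \<otimes> ?a) = punctured_count G j (y \<otimes> ?a)" by simp
    qed
  next
    case False
    \<comment> \<open>\<open>s = 0\<close> is impossible because 1 divides everything; the inclusion
      lemma needs non-divisibility by a successor power.\<close>
    then obtain s' where s': "s = Suc s'" by (cases s) auto
    have "powers G (p ^ s) \<subseteq> powers G (Suc j)"
      using powers_prime_power_subset[OF ex p, of "Suc j" s'] False
        powers_mono_dvd[of "p ^ s'" "p ^ s"] by (auto simp: s')
    then have "h \<in> powers G (Suc j)" using h by blast
    then show ?thesis using Suc.prems by (intro sum_powers_shift) auto
  qed
  moreover have "y \<otimes> h \<in> carrier G" using Suc.prems hc by simp
  ultimately have "punctured_count G (Suc j) (y \<otimes> h) + punctured_count G j (y \<otimes> h)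
      = punctured_count G (Suc j) y + punctured_count G j y"
    using punctured_count_Suc[OF fin] Suc.prems by (metis mult_cancel1 nat.distinct(1))
  then show ?case using Suc by simp
qed


section \<open>Sums of the counts over cosets\<close>

lemma sum_coset_shift:
  assumes H: "subgroup H G" and a: "a \<in> H" and z: "z \<in> carrier G"
  shows "(\<Sum>y\<in>H. f (z \<otimes> y \<otimes> a)) = (\<Sum>y\<in>H. f (z \<otimes> y))"
proof -
  interpret H: subgroup H G by (rule H)
  have "(\<Sum>y\<in>H. (\<lambda>y. f (z \<otimes> y)) (y \<otimes> a)) = (\<Sum>y\<in>H. f (z \<otimes> y))"
  proof (rule sum.reindex_bij_betw[of "\<lambda>y. y \<otimes> a"], rule bij_betw_byWitness[where f' = "\<lambda>y. y \<otimes> inv a"])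
  qed (use a in \<open>auto simp: m_assoc\<close>)
  also have "(\<Sum>y\<in>H. (\<lambda>y. f (z \<otimes> y)) (y \<otimes> a)) = (\<Sum>y\<in>H. f (z \<otimes> y \<otimes> a))"
    using a z by (intro sum.cong) (auto simp: m_assoc)
  finally show ?thesis .
qed

text \<open>Up to normalisation the difference below is a Fourier coefficient at a character of order
  \<open>p ^ Suc s\<close>. In the recursion it is multiplied by \<open>-1\<close> if \<open>p ^ Suc s\<close> does not divide \<open>Suc j\<close>,
  and by \<open>n / Suc j - 1\<close> otherwise.\<close>

lemma coset_sum_difference_nonzero:
  assumes fin: "finite (carrier G)"
    and ex: "\<forall>g\<in>carrier G. g [^] (p ^ e) = \<one>" and p: "prime (p::nat)"
    and w: "w \<in> powers G (p ^ s)" "w \<notin> powers G (p ^ Suc s)"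
    and j: "j < card (carrier G)"
  shows "(\<Sum>y\<in>powers G (p ^ Suc s). real (punctured_count G j y))
      \<noteq> (\<Sum>y\<in>powers G (p ^ Suc s). real (punctured_count G j (w \<otimes> y)))"
  using j
proof (induction j)
  case 0
  let ?H = "powers G (p ^ Suc s)"
  interpret H: subgroup ?H G by (rule powers_subgroup)
  interpret K: subgroup "powers G (p ^ s)" G by (rule powers_subgroup)
  have finH: "finite ?H" by (rule finite_subset[OF H.subset fin])
  \<comment> \<open>At size 0 the count is supported at \<open>\<one>\<close>, which lies in
    \<open>?H\<close> and hence not in the coset of \<open>w\<close>.\<close>
  have "w \<otimes> y \<noteq> \<one>" if "y \<in> ?H" for y
  proof
    assume "w \<otimes> y = \<one>"
    then have "w = inv y" using that w by (metis H.mem_carrier K.mem_carrier inv_equality inv_inv)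
    then show False using that w H.m_inv_closed by metis
  qed
  then have "(\<Sum>y\<in>?H. real (punctured_count G 0 (w \<otimes> y))) = 0"
    by (intro sum.neutral) (simp add: punctured_count_0)
  moreover have "(\<Sum>y\<in>?H. real (punctured_count G 0 y)) = 1"
    using finH H.one_closed
    by (simp add: punctured_count_0 if_distrib[of real] sum.delta cong: if_cong del: power_Suc)
  ultimately show ?case by simp
next
  case (Suc j)
  let ?H = "powers G (p ^ Suc s)"
  let ?f = "\<lambda>y. real (punctured_count G j y)"
  interpret H: subgroup ?H G by (rule powers_subgroup)
  interpret K: subgroup "powers G (p ^ s)" G by (rule powers_subgroup)
  \<comment> \<open>\<open>A i z\<close> sums the counts over the coset of \<open>z\<close>;
    \<open>S z\<close> sums the right-hand side of the recursion over it.\<close>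
  define A where "A i z = (\<Sum>y\<in>?H. real (punctured_count G i (z \<otimes> y)))" for i z
  define S where "S z = (\<Sum>y\<in>?H. \<Sum>v\<in>carrier G. ?f (z \<otimes> y \<otimes> inv (v [^] Suc j)))" for z
  have wc: "w \<in> carrier G" using w by simp
  have rec: "real (Suc j) * (A (Suc j) z + A j z) = S z" if z: "z \<in> carrier G" for z
  proof -
    have "real (Suc j) * (real (punctured_count G (Suc j) (z \<otimes> y)) + ?f (z \<otimes> y))
        = (\<Sum>v\<in>carrier G. ?f (z \<otimes> y \<otimes> inv (v [^] Suc j)))" if y: "y \<in> ?H" for y
      using punctured_count_Suc[OF fin, of "z \<otimes> y" j] y z
      by (metis H.mem_carrier m_closed of_nat_add of_nat_mult of_nat_sum)
    then show ?thesis
      by (simp add: A_def S_def sum_distrib_left sum.distrib[symmetric] del: nat_pow_Suc of_nat_Suc)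
  qed
  have IH: "A j \<one> \<noteq> A j w"
    using Suc by (simp add: A_def)
  have "A (Suc j) \<one> \<noteq> A (Suc j) w"
  proof (cases "p ^ Suc s dvd Suc j")
    case True
    \<comment> \<open>Every shift lies in \<open>?H\<close> and only permutes the coset, so each
      \<open>v\<close> contributes \<open>A j z\<close>.\<close>
    have "S z = card (carrier G) * A j z" if z: "z \<in> carrier G" for z
    proof -
      have "S z = (\<Sum>v\<in>carrier G. \<Sum>y\<in>?H. ?f (z \<otimes> y \<otimes> inv (v [^] Suc j)))"
        unfolding S_def by (rule sum.swap)
      also have "\<dots> = (\<Sum>v\<in>carrier G. A j z)"
        unfolding A_def
      proof (rule sum.cong[OF refl])
        fix v assume "v \<in> carrier G"
        then have "inv (v [^] Suc j) \<in> ?H"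
          using powers_mono_dvd[OF True] powersI[of v "Suc j"] by blast
        then show "(\<Sum>y\<in>?H. ?f (z \<otimes> y \<otimes> inv (v [^] Suc j))) = (\<Sum>y\<in>?H. ?f (z \<otimes> y))"
          using z by (intro sum_coset_shift powers_subgroup)
      qed
      finally show ?thesis by simp
    qed
    then have "real (Suc j) * (A (Suc j) z) = (real (card (carrier G)) - real (Suc j)) * A j z"
      if "z \<in> carrier G" for z
      using rec[OF that] that by (simp add: algebra_simps)
    \<comment> \<open>The factor \<open>card (carrier G) - Suc j\<close> is positive, so the
      inequality survives.\<close>
    then show ?thesis
      using IH Suc.prems wc by (metis diff_gt_0_iff_gt mult_left_cancel of_nat_less_iff one_closed order_less_irrefl)
  next
    case False
    \<comment> \<open>Here the shift by \<open>w\<close> is absorbed into the sum over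
      \<open>v\<close>. So \<open>S\<close> does not separate the two cosets, and the difference of
      the \<open>A\<close> values merely changes sign.\<close>
    have "w \<in> powers G (Suc j)"
      using powers_prime_power_subset[OF ex p _ False] w by auto
    then have "(\<Sum>v\<in>carrier G. ?f (y \<otimes> w \<otimes> inv (v [^] Suc j))) = (\<Sum>v\<in>carrier G. ?f (y \<otimes> inv (v [^] Suc j)))"
      if "y \<in> ?H" for y
      using that by (intro sum_powers_shift) auto
    then have "S w = S \<one>"
      using wc by (simp add: S_def m_comm[OF wc] cong: sum.cong)
    then have "A (Suc j) \<one> + A j \<one> = A (Suc j) w + A j w"
      using rec wc by (metis mult_left_cancel nat.distinct(1) of_nat_eq_0_iff one_closed)
    then show ?thesis using IH by linarith
  qed
  then show ?case by (simp add: A_def)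
qed

text \<open>Once the descending chain of \<open>p\<close>-power subgroups stalls, it stalls forever,
  yet it reaches the trivial group after \<open>e\<close> further steps.\<close>

lemma trivial_powers_if_stationary:
  assumes ex: "\<forall>g\<in>carrier G. g [^] (p ^ e) = \<one>" and st: "powers G (p ^ s) \<subseteq> powers G (p ^ Suc s)"
  shows "powers G (p ^ s) = {\<one>}"
proof -
  have "powers G (p ^ s) \<subseteq> powers G (p ^ (s + i))" for i
  proof (induction i)
    case (Suc i)
    show ?case
    proof
      fix h assume "h \<in> powers G (p ^ s)"
      then obtain g where g: "g \<in> carrier G" "h = g [^] p ^ (s + i)" using Suc by (auto simp: powers_def)
      have "g [^] p ^ s \<in> powers G (p ^ Suc s)" using st powersI[OF g(1)] by blast
      then obtain g' where g': "g' \<in> carrier G" "g [^] p ^ s = g' [^] p ^ Suc s" by (auto simp: powers_def)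
      have "h = (g [^] p ^ s) [^] p ^ i" using g by (simp add: nat_pow_pow power_add)
      also have "\<dots> = g' [^] p ^ (s + Suc i)" using g' by (simp add: nat_pow_pow power_add mult_ac)
      finally show "h \<in> powers G (p ^ (s + Suc i))" using powersI[OF g'(1)] by simp
    qed
  qed simp
  from this[of e] have "powers G (p ^ s) \<subseteq> {\<one>}"
    using ex by (auto simp: powers_def power_add nat_pow_pow[symmetric] mult.commute[of "p ^ s"])
  then show ?thesis
    using subgroup.one_closed[OF powers_subgroup] by blast
qed

section \<open>Constancy of the counts on a coset\<close>

lemma punctured_count_constant_iff:
  assumes fin: "finite (carrier G)"
    and ex: "\<forall>g\<in>carrier G. g [^] (p ^ e) = \<one>" and p: "prime (p::nat)"
    and k: "Suc j < card (carrier G)" and x: "x \<in> carrier G"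
  shows "(\<exists>r. \<forall>v\<in>carrier G. punctured_count G j (x \<otimes> inv (v [^] Suc j)) = r)
    \<longleftrightarrow> x \<notin> powers G (Suc j) \<or> powers G (Suc j) = {\<one>}"
proof -
  define s where "s = multiplicity p (Suc j)"
  let ?K = "powers G (Suc j)"
  interpret K: subgroup ?K G by (rule powers_subgroup)
  have "p ^ s dvd Suc j" unfolding s_def by (rule multiplicity_dvd)
  moreover have nd: "\<not> p ^ Suc s dvd Suc j"
  proof
    assume "p ^ Suc s dvd Suc j"
    then have "Suc s \<le> multiplicity p (Suc j)"
      using p by (intro multiplicity_geI) auto
    then show False by (simp add: s_def)
  qed
  ultimately have K: "?K = powers G (p ^ s)"
    using powers_mono_dvd powers_prime_power_subset[OF ex p _ nd] by blast
  show ?thesis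
  proof
    assume "\<exists>r. \<forall>v\<in>carrier G. punctured_count G j (x \<otimes> inv (v [^] Suc j)) = r"
    then obtain r where r: "\<And>v. v \<in> carrier G \<Longrightarrow> punctured_count G j (x \<otimes> inv (v [^] Suc j)) = r" by auto
    show "x \<notin> ?K \<or> ?K = {\<one>}"
    proof (rule ccontr)
      assume neg: "\<not> ?thesis"
      \<comment> \<open>As \<open>x\<close> lies in \<open>?K\<close>, its coset is
        \<open>?K\<close> itself, so every \<open>y\<close> in \<open>?K\<close> occurs as an
        argument.\<close>
      have const: "punctured_count G j y = r" if y: "y \<in> ?K" for y
      proof -
        have "inv y \<otimes> x \<in> ?K" using y neg by blast
        then obtain v where v: "v \<in> carrier G" "inv y \<otimes> x = v [^] Suc j" by (auto simp: powers_def)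
        have "x \<otimes> inv (inv y \<otimes> x) = y"
          using K.mem_carrier[OF y] x by (simp add: inv_mult_group m_assoc[symmetric])
        then have "x \<otimes> inv (v [^] Suc j) = y" by (simp only: v(2))
        then show ?thesis using r[OF v(1)] by simp
      qed
      \<comment> \<open>If there were no such \<open>w\<close>, the chain would stall at
        \<open>s\<close> and \<open>?K\<close> would be trivial.\<close>
      obtain w where w: "w \<in> powers G (p ^ s)" "w \<notin> powers G (p ^ Suc s)"
        using trivial_powers_if_stationary[OF ex] neg K by blast
      have sub: "powers G (p ^ Suc s) \<subseteq> ?K" unfolding K by (intro powers_mono_dvd) auto
      \<comment> \<open>Both cosets lie in \<open>?K\<close>, so constancy forces equal sums,
        against \<open>coset_sum_difference_nonzero\<close>.\<close>
      have "(\<Sum>y\<in>powers G (p ^ Suc s). real (punctured_count G j y)) =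
          (\<Sum>y\<in>powers G (p ^ Suc s). real (punctured_count G j (w \<otimes> y)))"
      proof (rule sum.cong[OF refl])
        fix y assume "y \<in> powers G (p ^ Suc s)"
        then have "y \<in> ?K" "w \<otimes> y \<in> ?K" using w sub K by (blast intro: K.m_closed)+
        then show "real (punctured_count G j y) = real (punctured_count G j (w \<otimes> y))"
          by (simp add: const)
      qed
      then show False
        using coset_sum_difference_nonzero[OF fin ex p w, of j] k by simp
    qed
  next
    assume "x \<notin> ?K \<or> ?K = {\<one>}"
    then have "punctured_count G j (x \<otimes> inv (v [^] Suc j)) = punctured_count G j x" if v: "v \<in> carrier G" for v
    proof
      assume "x \<notin> ?K"
      then show ?thesis
        using punctured_count_shift[OF fin ex p x, of s "inv (v [^] Suc j)"] powersI[OF v, of "Suc j"] K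
          K.m_inv_closed by metis
    next
      assume "?K = {\<one>}"
      then show ?thesis using powersI[OF v, of "Suc j"] x by (metis inv_one r_one singletonD)
    qed
    then show "\<exists>r. \<forall>v\<in>carrier G. punctured_count G j (x \<otimes> inv (v [^] Suc j)) = r" by blast
  qed
qed

section \<open>Existence of blocks in groups of odd order\<close>

text \<open>Collects \<open>l\<close> pairs \<open>{a, inv a}\<close>; removing a pair leaves a set
  of the same kind.\<close>

lemma ex_even_subset_finprod_one:
  assumes "finite S" "S \<subseteq> carrier G" "\<forall>a\<in>S. inv a \<in> S \<and> inv a \<noteq> a" "2 * l \<le> card S"
  shows "\<exists>T\<subseteq>S. card T = 2 * l \<and> finprod G (\<lambda>g. g) T = \<one>"
  using assms
proof (induction l arbitrary: S)
  case 0
  show ?case by (intro exI[of _ "{}"]) auto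
next
  case (Suc l)
  then obtain a where a: "a \<in> S" by fastforce
  let ?S = "S - {a, inv a}"
  have ac: "a \<in> carrier G" "inv a \<in> S" "inv a \<noteq> a" using a Suc.prems by auto
  have "card ?S = card S - 2" using a ac Suc.prems by (subst card_Diff_subset) auto
  then have "2 * l \<le> card ?S" using Suc.prems by simp
  moreover have "inv b \<in> ?S \<and> inv b \<noteq> b" if b: "b \<in> ?S" for b
  proof -
    have "b \<in> carrier G" "inv b \<in> S" "inv b \<noteq> b" using b Suc.prems by auto
    moreover have "inv b \<noteq> a" "inv b \<noteq> inv a"
      using b ac \<open>b \<in> carrier G\<close> by (metis Diff_iff insertCI inv_inv)+
    ultimately show ?thesis by simp
  qed
  ultimately obtain T where T: "T \<subseteq> ?S" "card T = 2 * l" "finprod G (\<lambda>g. g) T = \<one>"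
    using Suc.IH[of ?S] Suc.prems by auto
  have finT: "finite T" using T Suc.prems by (meson finite_Diff finite_subset)
  have "finprod G (\<lambda>g. g) (insert a (insert (inv a) T)) = a \<otimes> (inv a \<otimes> finprod G (\<lambda>g. g) T)"
    using T ac Suc.prems finT by (subst finprod_insert, auto)+
  moreover have "card (insert a (insert (inv a) T)) = 2 * Suc l"
    using T ac finT by (subst card_insert_disjoint, auto)+
  ultimately show ?case
    using T ac a by (intro exI[of _ "insert a (insert (inv a) T)"]) auto
qed

lemma inv_eq_self_imp_one:
  assumes odd: "odd (q::nat)" and ex: "\<forall>g\<in>carrier G. g [^] q = \<one>"
    and a: "a \<in> carrier G" "inv a = a"
  shows "a = \<one>"
proof -
  have aa: "a \<otimes> a = \<one>" using a by (metis r_inv)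
  obtain r where r: "q = Suc (2 * r)" using odd by (metis oddE Suc_eq_plus1)
  have "a [^] (2::nat) = \<one>" using a aa by (simp add: numeral_2_eq_2)
  then have "a [^] (2 * r) = \<one>" using a by (metis nat_pow_one nat_pow_pow)
  then show ?thesis using ex a r by force
qed

text \<open>Reindexing by inversion shows that the product is its own inverse, and an odd exponent
  excludes elements of order two.\<close>

lemma finprod_carrier_one:
  assumes odd: "odd (q::nat)" and ex: "\<forall>g\<in>carrier G. g [^] q = \<one>"
  shows "finprod G (\<lambda>g. g) (carrier G) = \<one>"
proof -
  let ?P = "finprod G (\<lambda>g. g) (carrier G)"
  have "inj_on (\<lambda>g. inv g) (carrier G)" by (metis inj_onI inv_inv)
  moreover have "(\<lambda>g. inv g) ` carrier G = carrier G"
    by (metis (no_types, lifting) inv_closed inv_inv image_iff subsetI subset_antisym image_subsetI)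
  ultimately have "?P = finprod G (\<lambda>g. inv g) (carrier G)"
    using finprod_reindex[of "\<lambda>g. g" "\<lambda>g. inv g" "carrier G"] by (simp add: Pi_def)
  moreover have "finprod G (\<lambda>g. g \<otimes> inv g) (carrier G) = \<one>"
    by (rule finprod_one_eqI) simp
  then have "?P \<otimes> finprod G (\<lambda>g. inv g) (carrier G) = \<one>"
    by (subst (asm) finprod_multf) auto
  ultimately have "?P \<otimes> ?P = \<one>" by simp
  moreover have "?P \<in> carrier G" by (rule finprod_closed) auto
  ultimately show ?thesis
    using inv_eq_self_imp_one[OF odd ex, of ?P] by (metis inv_equality)
qed

lemma blocks_nonempty:
  assumes fin: "finite (carrier G)" and odd_card: "odd (card (carrier G))"
    and odd: "odd (q::nat)" and ex: "\<forall>g\<in>carrier G. g [^] q = \<one>"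
    and k: "0 < k" "k < card (carrier G)" and x: "x \<in> carrier G"
  shows "blocks G k x \<noteq> {}"
proof -
  note no_fix = inv_eq_self_imp_one[OF odd ex]
  \<comment> \<open>A small core \<open>C\<close> with product \<open>x\<close> is padded by
    \<open>l\<close> inverse pairs from outside \<open>B\<close>, which is closed under inverses and
    contains \<open>\<one>\<close>.\<close>
  have build: "blocks G k x \<noteq> {}"
    if B: "B \<subseteq> carrier G" "\<one> \<in> B" "\<forall>b\<in>B. inv b \<in> B" and C: "C \<subseteq> B" "finprod G (\<lambda>g. g) C = x"
      and kl: "k = card C + 2 * l" and l: "2 * l \<le> card (carrier G) - card B" for B C l
  proof -
    have finBC: "finite B" "finite C" using B C fin by (meson finite_subset)+
    have S: "\<forall>a\<in>carrier G - B. inv a \<in> carrier G - B \<and> inv a \<noteq> a"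
      using B no_fix by (metis Diff_iff inv_closed inv_inv)
    have "card (carrier G - B) = card (carrier G) - card B"
      using B finBC by (simp add: card_Diff_subset)
    then obtain T where T: "T \<subseteq> carrier G - B" "card T = 2 * l" "finprod G (\<lambda>g. g) T = \<one>"
      using ex_even_subset_finprod_one[OF _ _ S, of l] fin l by auto
    have finT: "finite T" using T fin by (meson finite_Diff finite_subset)
    have disj: "C \<inter> T = {}" using T C by auto
    have "finprod G (\<lambda>g. g) (C \<union> T) = x"
      using T C B x finT finBC disj by (subst finprod_Un_disjoint) (auto simp: subset_iff)
    moreover have "card (C \<union> T) = k"
      using T kl finT finBC disj by (simp add: card_Un_disjoint)
    ultimately have "C \<union> T \<in> blocks G k x"
      using T C B finT finBC by (auto simp: blocks_def)
    then show ?thesis by blast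
  qed
  show ?thesis
  \<comment> \<open>The core has the parity of \<open>k\<close>: the empty set or
    \<open>{\<one>}\<close> if \<open>x = \<one>\<close>, otherwise \<open>{\<one>, x}\<close> or
    \<open>{x}\<close>. Oddness of the group order leaves enough room for the pairs.\<close>
  proof (cases "x = \<one>")
    case True
    show ?thesis
    proof (cases "even k")
      case True
      then show ?thesis
        using k \<open>x = \<one>\<close> odd_card by (intro build[of "{\<one>}" "{}" "k div 2"]) auto
    next
      case False
      then show ?thesis
        using k \<open>x = \<one>\<close> odd_card by (intro build[of "{\<one>}" "{\<one>}" "k div 2"]) (auto elim!: oddE)
    qed
  next
    case False
    have ne: "inv x \<noteq> x" "inv x \<noteq> \<one>"
      using False x no_fix by (auto simp: inv_eq_1_iff)
    then have card3: "card {\<one>, x, inv x} = 3" using False by auto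
    show ?thesis
    proof (cases "even k")
      case True
      then obtain l where l: "k = 2 * Suc l" using k(1) by (metis evenE mult_0_right not_gr_zero old.nat.exhaust)
      have c2: "card {\<one>, x} = 2" using False by simp
      show ?thesis
        using l k x False odd_card card3 c2
        by (intro build[of "{\<one>, x, inv x}" "{\<one>, x}" l]) (auto elim!: oddE)
    next
      case False
      then obtain l where l: "k = 2 * l + 1" by (elim oddE)
      then have "2 * l \<le> card (carrier G) - 3" using k odd_card by (auto elim!: oddE)
      then show ?thesis
        using l x card3 by (intro build[of "{\<one>, x, inv x}" "{x}" l]) auto
    qed
  qed
qed

section \<open>The design criterion in terms of powers\<close>

lemma one_design_blocks_iff:
  assumes fin: "finite (carrier G)" and odd_card: "odd (card (carrier G))"
    and ex: "\<forall>g\<in>carrier G. g [^] (p ^ e) = \<one>" and p: "prime (p::nat)" "odd p"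
    and k: "0 < k" "k < card (carrier G)" and x: "x \<in> carrier G"
  shows "(\<exists>r. one_design (carrier G) (blocks G k x) (card (carrier G)) k r)
    \<longleftrightarrow> x \<notin> powers G k \<or> powers G k = {\<one>}"
proof -
  obtain j where j: "k = Suc j" using k by (cases k) auto
  obtain b where b: "b \<in> blocks G k x"
    using blocks_nonempty[OF fin odd_card _ ex k x] p by auto
  then obtain v where v: "v \<in> b" using k by (auto simp: blocks_def card_gt_0_iff)
  \<comment> \<open>An existing block has a point, so a constant count is automatically positive and
    only constancy remains to be decided.\<close>
  have "0 < r" if "\<forall>v\<in>carrier G. card {b \<in> blocks G k x. v \<in> b} = r" for r
  proof -
    have "v \<in> carrier G" using b v by (auto dest: blocksD)
    moreover have "0 < card {b \<in> blocks G k x. v \<in> b}"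
      using b v finite_blocks[OF fin] by (auto simp: card_gt_0_iff)
    ultimately show ?thesis using that by auto
  qed
  then have "(\<exists>r. one_design (carrier G) (blocks G k x) (card (carrier G)) k r)
      \<longleftrightarrow> (\<exists>r. \<forall>v\<in>carrier G. card {b \<in> blocks G k x. v \<in> b} = r)"
    using fin by (auto simp: one_design_def blocks_def)
  also have "\<dots> \<longleftrightarrow> x \<notin> powers G k \<or> powers G k = {\<one>}"
    using punctured_count_constant_iff[OF fin ex p(1) k(2)[unfolded j] x]
      card_blocks_through[OF x] by (simp add: j del: nat_pow_Suc)
  finally show ?thesis .
qed

text \<open>The only candidate block is the whole group, with product \<open>\<one>\<close>; for
  other \<open>x\<close> there is no block and \<open>r\<close> would have to be 0.\<close>

lemma one_design_blocks_carrier_iff: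
  assumes fin: "finite (carrier G)" and odd: "odd (q::nat)" and ex: "\<forall>g\<in>carrier G. g [^] q = \<one>"
  shows "(\<exists>r. one_design (carrier G) (blocks G (card (carrier G)) x) (card (carrier G)) (card (carrier G)) r)
    \<longleftrightarrow> x = \<one>"
proof -
  have "b = carrier G" if "b \<subseteq> carrier G" "card b = card (carrier G)" for b
    using that fin by (simp add: card_subset_eq)
  then have B: "blocks G (card (carrier G)) x = (if x = \<one> then {carrier G} else {})"
    using finprod_carrier_one[OF odd ex] fin by (auto simp: blocks_def)
  have "{b. b = carrier G \<and> v \<in> b} = {carrier G}" if "v \<in> carrier G" for v using that by auto
  then show ?thesis
    using fin one_closed by (auto simp: B one_design_def)
qed

end

section \<open>Coordinates in a finite direct sum of cyclic groups\<close>

context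
  fixes G :: "('a, 'b) monoid_scheme" (structure)
    and I :: "nat set" and q :: "nat \<Rightarrow> nat" and \<phi> :: "'a \<Rightarrow> nat \<Rightarrow> int"
  assumes G: "comm_group G" and fin: "finite I" and q: "\<forall>i\<in>I. 0 < q i"
    and iso: "\<phi> \<in> iso G (sum_group I (\<lambda>i. integer_mod_group (q i)))"
begin

interpretation comm_group G by (rule G)

lemma coords_bij_betw: "bij_betw \<phi> (carrier G) (\<Pi>\<^sub>E i\<in>I. {0..<int (q i)})"
proof -
  \<comment> \<open>Finiteness of \<open>I\<close> makes the finite-support condition vacuous;
    positivity of \<open>q i\<close> excludes the infinite cyclic group
    \<open>integer_mod_group 0\<close>.\<close>
  have "carrier (sum_group I (\<lambda>i. integer_mod_group (q i))) = (\<Pi>\<^sub>E i\<in>I. {0..<int (q i)})"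
    using q fin by (simp add: carrier_sum_group carrier_integer_mod_group) (intro PiE_cong, auto)
  then show ?thesis using iso by (simp add: iso_def)
qed

lemma coords_in:
  assumes "x \<in> carrier G"
  shows "\<phi> x \<in> (\<Pi>\<^sub>E i\<in>I. {0..<int (q i)})"
  using coords_bij_betw assms by (auto simp: bij_betw_def)

lemma coords_eqI:
  assumes "x \<in> carrier G" "y \<in> carrier G" "\<And>i. i \<in> I \<Longrightarrow> \<phi> x i = \<phi> y i"
  shows "x = y"
proof -
  have "\<phi> x = \<phi> y"
    using coords_in[OF assms(1)] coords_in[OF assms(2)] assms(3) by (rule PiE_ext)
  then show ?thesis
    using coords_bij_betw assms by (auto simp: bij_betw_def inj_on_def)
qed

lemma ex_coords:
  assumes "\<And>i. i \<in> I \<Longrightarrow> 0 \<le> f i \<and> f i < int (q i)"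
  obtains g where "g \<in> carrier G" "\<And>i. i \<in> I \<Longrightarrow> \<phi> g i = f i"
proof -
  have "restrict f I \<in> (\<Pi>\<^sub>E i\<in>I. {0..<int (q i)})" using assms by auto
  then obtain g where "g \<in> carrier G" "\<phi> g = restrict f I"
    using coords_bij_betw by (metis bij_betw_imp_surj_on imageE)
  then show ?thesis using that by simp
qed

lemma coords_one: "i \<in> I \<Longrightarrow> \<phi> \<one> i = 0"
proof -
  have "group (sum_group I (\<lambda>i. integer_mod_group (q i)))" by simp
  then have "\<phi> \<one> = \<one>\<^bsub>sum_group I (\<lambda>i. integer_mod_group (q i))\<^esub>"
    using iso by (intro hom_one) (auto simp: iso_def)
  then show "i \<in> I \<Longrightarrow> \<phi> \<one> i = 0" by simp
qed

lemma coords_pow: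
  assumes "g \<in> carrier G" "i \<in> I"
  shows "\<phi> (g [^] k) i = (int k * \<phi> g i) mod int (q i)"
proof (induction k)
  case 0
  then show ?case using assms by (simp add: coords_one)
next
  case (Suc k)
  have "\<phi> (g [^] k \<otimes> g) = \<phi> (g [^] k) \<otimes>\<^bsub>sum_group I (\<lambda>i. integer_mod_group (q i))\<^esub> \<phi> g"
    using iso assms by (intro hom_mult) (auto simp: iso_def)
  then have "\<phi> (g [^] Suc k) i = (\<phi> (g [^] k) i + \<phi> g i) mod int (q i)"
    using assms by simp
  then show ?case using Suc by (simp add: mod_simps algebra_simps)
qed

lemma card_coords: "card (carrier G) = (\<Prod>i\<in>I. q i)"
  using bij_betw_same_card[OF coords_bij_betw] fin by (simp add: card_PiE)

lemma coords_exponent: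
  assumes "\<forall>i\<in>I. q i dvd k" "g \<in> carrier G"
  shows "g [^] k = \<one>"
proof (rule coords_eqI)
  fix i assume "i \<in> I"
  then have "int (q i) dvd int k" using assms by simp
  then show "\<phi> (g [^] k) i = \<phi> \<one> i"
    using assms \<open>i \<in> I\<close> by (simp add: coords_pow coords_one)
qed (use assms in auto)

text \<open>Coordinatewise, a linear congruence with coefficient \<open>k\<close> modulo
  \<open>q i\<close> is solvable exactly if the gcd divides the right-hand side.\<close>

lemma mem_powers_iff_coords:
  assumes x: "x \<in> carrier G"
  shows "x \<in> powers G k \<longleftrightarrow> (\<forall>i\<in>I. int (gcd k (q i)) dvd \<phi> x i)"
proof
  assume "x \<in> powers G k"
  then obtain g where g: "g \<in> carrier G" "x = g [^] k" by (auto simp: powers_def)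
  show "\<forall>i\<in>I. int (gcd k (q i)) dvd \<phi> x i"
  proof
    fix i assume "i \<in> I"
    then show "int (gcd k (q i)) dvd \<phi> x i"
      unfolding g(2) coords_pow[OF g(1) \<open>i \<in> I\<close>] by (intro dvd_mod dvd_mult2) auto
  qed
next
  assume dvd: "\<forall>i\<in>I. int (gcd k (q i)) dvd \<phi> x i"
  have "\<exists>z. 0 \<le> z \<and> z < int (q i) \<and> (int k * z) mod int (q i) = \<phi> x i" if i: "i \<in> I" for i
  proof -
    have "gcd (int k) (int (q i)) dvd \<phi> x i" using dvd i by simp
    then obtain c where c: "\<phi> x i = gcd (int k) (int (q i)) * c" by (elim dvdE)
    obtain u v where uv: "u * int k + v * int (q i) = gcd (int k) (int (q i))"
      using bezout_int by blast
    \<comment> \<open>The Bezout coefficient \<open>u\<close>, scaled by \<open>c\<close>, solves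
      the congruence; it is later reduced to a representative in range.\<close>
    have "int k * (u * c) = \<phi> x i + int (q i) * (- v * c)"
      unfolding c uv[symmetric] by (simp add: algebra_simps)
    then have "(int k * (u * c)) mod int (q i) = \<phi> x i mod int (q i)" by (metis mod_mult_self2)
    moreover have "\<phi> x i mod int (q i) = \<phi> x i"
      using coords_in[OF x] i by (intro mod_pos_pos_trivial) (auto simp: PiE_iff)
    ultimately show ?thesis
      using q i by (intro exI[of _ "(u * c) mod int (q i)"]) (simp add: mod_simps)
  qed
  then obtain z where z: "\<And>i. i \<in> I \<Longrightarrow> 0 \<le> z i \<and> z i < int (q i) \<and> (int k * z i) mod int (q i) = \<phi> x i"
    by metis
  obtain g where g: "g \<in> carrier G" "\<And>i. i \<in> I \<Longrightarrow> \<phi> g i = z i"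
    using ex_coords[of z] z by blast
  have "g [^] k = x"
    using g x z by (intro coords_eqI) (auto simp: coords_pow)
  then show "x \<in> powers G k" using g by (auto simp: powers_def)
qed

lemma powers_trivial_iff_coords: "powers G k = {\<one>} \<longleftrightarrow> (\<forall>i\<in>I. q i dvd k)"
proof
  assume triv: "powers G k = {\<one>}"
  show "\<forall>i\<in>I. q i dvd k"
  proof
    fix i0 assume i0: "i0 \<in> I"
    \<comment> \<open>The element with all coordinates 1 tests triviality; the reduction covers
      \<open>q i = 1\<close>, where 1 is not a representative.\<close>
    obtain g where g: "g \<in> carrier G" "\<And>i. i \<in> I \<Longrightarrow> \<phi> g i = 1 mod int (q i)"
      using ex_coords[of "\<lambda>i. 1 mod int (q i)"] q by auto
    have "g [^] k = \<one>" using triv powersI[OF g(1), of k] by auto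
    then have "int k mod int (q i0) = 0"
      using coords_pow[OF g(1) i0, of k] g(2)[OF i0] coords_one[OF i0] by (simp add: mod_simps)
    then show "q i0 dvd k" by presburger
  qed
next
  assume "\<forall>i\<in>I. q i dvd k"
  then show "powers G k = {\<one>}"
    using coords_exponent one_closed by (auto simp: powers_def image_iff)
qed

end

section \<open>Divisibility expressed by valuations\<close>

lemma prime_power_gcd_dvd_iff:
  fixes p t k :: nat and y :: int
  assumes p: "prime p" and t: "1 \<le> t" and k: "0 < k" "p dvd k"
  shows "\<not> int (gcd k (p ^ t)) dvd y \<longleftrightarrow> \<nu> p (int k) - \<nu>_loc p t y \<ge> 1"
proof (cases "int (p ^ t) dvd y")
  case True
  then have "int (gcd k (p ^ t)) dvd y" by (meson dvd_trans gcd_dvd2 int_dvd_int_iff)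
  moreover have "[y = 0] (mod int (p ^ t))" using True by (simp add: cong_0_iff)
  \<comment> \<open>The difference of valuations is \<open>-\<infinity>\<close> here, so both sides
    are false.\<close>
  ultimately show ?thesis using k by (simp add: \<nu>_def \<nu>_loc_def)
next
  case False
  then have y: "y \<noteq> 0" by auto
  have pp: "prime (int p)" using p by simp
  have pow: "int p ^ a dvd int k \<longleftrightarrow> a \<le> multiplicity (int p) (int k)"
    "int p ^ a dvd y \<longleftrightarrow> a \<le> multiplicity (int p) y" for a
    using k y pp by (intro power_dvd_iff_le_multiplicity; auto)+
  let ?s = "multiplicity (int p) (int k)" and ?r = "multiplicity (int p) y"
  obtain a where a: "a \<le> t" "gcd k (p ^ t) = p ^ a"
    using divides_primepow_nat[OF p, of "gcd k (p ^ t)" t] by auto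
  have r: "?r < t" using False pow(2)[of t] by auto
  \<comment> \<open>The gcd is \<open>p ^ min ?s t\<close>; since \<open>?r < t\<close>, the
    truncation at \<open>t\<close> does not affect the comparison with \<open>?r\<close>.\<close>
  have "a \<le> ?s"
    using gcd_dvd1[of k "p ^ t"] pow(1)[of a] by (simp add: a flip: of_nat_power)
  moreover have "p ^ min ?s t dvd gcd k (p ^ t)"
    using pow(1)[of "min ?s t"] by (simp add: le_imp_power_dvd flip: of_nat_power)
  then have "min ?s t \<le> a"
    using p by (auto simp: a intro: power_dvd_imp_le prime_gt_1_nat)
  ultimately have "a = min ?s t" using a by simp
  then have "int (gcd k (p ^ t)) dvd y \<longleftrightarrow> min ?s t \<le> ?r"
    using pow(2)[of a] a by simp
  also have "\<dots> \<longleftrightarrow> ?s \<le> ?r" using r by auto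
  finally have "\<not> int (gcd k (p ^ t)) dvd y \<longleftrightarrow> 1 \<le> real ?s - real ?r" by auto
  moreover have "\<not> [y = 0] (mod int (p ^ t))" using False by (simp add: cong_0_iff)
  ultimately show ?thesis
    using y k by (simp add: \<nu>_def \<nu>_loc_def one_ereal_def)
qed

section \<open>The criterion in coordinates\<close>

theorem theorem3:
  fixes G :: "('a, 'b) monoid_scheme" (structure)
    and p m n k :: nat and t :: "nat \<Rightarrow> nat"
    and \<phi> :: "'a \<Rightarrow> nat \<Rightarrow> int" and x :: 'a
  assumes "prime p" and "odd p"
    and "1 \<le> m" and "\<forall>i\<in>{1..m}. 1 \<le> t i" and "mono_on {1..m} t"
    and "comm_group G"
    and "\<phi> \<in> iso G (sum_group {1..m} (\<lambda>i. integer_mod_group (p ^ t i)))"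
    and "card (carrier G) = n"
    and "1 \<le> k" and "k \<le> n"
    and "x \<in> carrier G"
  shows "(\<exists>r. one_design (carrier G) (blocks G k x) n k r) \<longleftrightarrow>
    p dvd k \<and>
    (((p ^ t m dvd k \<and> k \<noteq> n) \<or> (k = n \<and> x = \<one>\<^bsub>G\<^esub>)) \<or>
     (k \<noteq> n \<and> (\<exists>i\<in>{1..m}. \<not> int p dvd \<phi> x i)) \<or>
     (k \<noteq> n \<and> (\<forall>i\<in>{1..m}. int p dvd \<phi> x i) \<and>
        Max ((\<lambda>i. \<nu> p (int k) - \<nu>_loc p (t i) (\<phi> x i)) ` {1..m}) \<ge> 1))"
proof -
  interpret comm_group G by fact
  let ?I = "{1..m}"
  note p = assms(1,2) and t = assms(4) and n = assms(8) and x = assms(11)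
  have pos: "\<forall>i\<in>?I. 0 < p ^ t i" using p by (simp add: prime_gt_0_nat)
  note coords = comm_group_axioms finite_atLeastAtMost[of 1 m] pos assms(7)
  have mI: "m \<in> ?I" using assms(3) by simp
  \<comment> \<open>Monotonicity makes \<open>p ^ t m\<close> a common multiple of all
    \<open>p ^ t i\<close>, hence an exponent of the group.\<close>
  have tm: "p ^ t i dvd p ^ t m" if "i \<in> ?I" for i
    using that mI by (intro le_imp_power_dvd mono_onD[OF assms(5)]) auto
  have ex: "\<forall>g\<in>carrier G. g [^] (p ^ t m) = \<one>"
    using coords_exponent[OF coords] tm by blast
  have n_eq: "n = (\<Prod>i\<in>?I. p ^ t i)"
    using card_coords[OF coords] n by simp
  have odd_n: "odd (card (carrier G))"
    using p by (simp add: n n_eq even_prod_iff)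
  have fin: "finite (carrier G)"
    using odd_n by (metis card.infinite dvd_0_right)
  have pn: "p dvd n"
    unfolding n_eq using mI t by (meson dvd_prodI dvd_trans finite_atLeastAtMost dvd_power less_le_trans zero_less_one)
  show ?thesis
  proof (cases "k = n")
    case True
    then show ?thesis
      using one_design_blocks_carrier_iff[OF fin _ ex, of x] p pn n by simp
  next
    case False
    then have k: "0 < k" "k < card (carrier G)" using assms by auto
    have design: "(\<exists>r. one_design (carrier G) (blocks G k x) n k r) \<longleftrightarrow>
        (\<exists>i\<in>?I. \<not> int (gcd k (p ^ t i)) dvd \<phi> x i) \<or> p ^ t m dvd k"
      using one_design_blocks_iff[OF fin odd_n ex p k x] mem_powers_iff_coords[OF coords x, of k]
        powers_trivial_iff_coords[OF coords, of k] mI tm dvd_trans n by metis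
    show ?thesis
    proof (cases "p dvd k")
      case False
      \<comment> \<open>Every element is a \<open>k\<close>-th power and the group is nontrivial, so
        both alternatives in \<open>design\<close> fail.\<close>
      have "gcd k (p ^ t i) = 1" for i
        using p False by (metis coprime_commute coprime_iff_gcd_eq_1 coprime_power_right_iff prime_imp_coprime)
      moreover have "\<not> p ^ t m dvd k"
        using False t mI by (meson dvd_power dvd_trans less_le_trans zero_less_one)
      ultimately show ?thesis using design False by simp
    next
      case True
      let ?f = "\<lambda>i. \<nu> p (int k) - \<nu>_loc p (t i) (\<phi> x i)"
      have "1 \<le> Max (?f ` ?I) \<longleftrightarrow> (\<exists>i\<in>?I. 1 \<le> ?f i)"
        using mI by (subst Max_ge_iff) auto
      also have "\<dots> \<longleftrightarrow> (\<exists>i\<in>?I. \<not> int (gcd k (p ^ t i)) dvd \<phi> x i)"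
        using prime_power_gcd_dvd_iff[OF p(1) _ k(1) True] t by (intro bex_cong) auto
      finally have Max: "1 \<le> Max (?f ` ?I) \<longleftrightarrow> (\<exists>i\<in>?I. \<not> int (gcd k (p ^ t i)) dvd \<phi> x i)" .
      \<comment> \<open>Condition (ii) also puts \<open>x\<close> outside the \<open>k\<close>-th
        powers, so (ii) and (iii) together say exactly that.\<close>
      have "\<not> int (gcd k (p ^ t i)) dvd \<phi> x i" if "i \<in> ?I" "\<not> int p dvd \<phi> x i" for i
      proof -
        have "0 < t i" using t that(1) by (metis less_le_trans zero_less_one)
        then have "p dvd gcd k (p ^ t i)" using True by simp
        then show ?thesis using that(2) by (meson dvd_trans int_dvd_int_iff)
      qed
      then show ?thesis using design Max True \<open>k \<noteq> n\<close> by blast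
    qed
  qed
qed

end
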